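(* Let $X$ be a Hilbert space, $K:(0,\infty) \to [0,1)$ and $T:X\to X$ such that $T$ is a contraction for large distances with modulus $K$ (so that $T$ is super strongly nonexpansive). Then $T$ admits the supercoercivity modulus $$\nu(M):= \max\left(2, \frac{4M}{1-(K(1))^2}\right).$$
   Context: $T:X\to X$ is a contraction for large distances with modulus $K:(0,\infty)\to[0,1)$ if for all $\varepsilon>0$ and $x,y\in X$ with $\|x-y\|\ge\varepsilon$, $\|Tx-Ty\|\le K(\varepsilon)\|x-y\|$. $T$ is super strongly nonexpansive if it is nonexpansive (i.e. $\|Tx-Ty\|\le\|x-y\|$ for all $x,y$) and, whenever $(x_n),(y_n)\subseteq X$ with $\|x_n-y_n\|^2-\|Tx_n-Ty_n\|^2\to0$, then $(x_n-y_n)-(Tx_n-Ty_n)\to0$. A function $\nu:(0,\infty)\to(0,\infty)$ is a supercoercivity modulus for a super strongly nonexpansive mapping $T:X\to X$ if for all $M>0$ and all $x,y\in X$ with $\|x-y\|^2-\|Tx-Ty\|^2<M\|(x-y)-(Tx-Ty)\|$, one has $\|(x-y)-(Tx-Ty)\|<\nu(M)$. *)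

theory Defs
  imports "HOL-Analysis.Analysis"
begin

(* Functions on (0,\<infinity>) are total functions on the reals, constrained
   only at positive arguments. *)

definition contraction_for_large_distances ::
    "('a::real_normed_vector \<Rightarrow> 'a) \<Rightarrow> (real \<Rightarrow> real) \<Rightarrow> bool" where
  "contraction_for_large_distances T K \<longleftrightarrow>
     K \<in> {0<..} \<rightarrow> {0..<1} \<and>
     (\<forall>\<epsilon>>0. \<forall>x y. norm (x - y) \<ge> \<epsilon> \<longrightarrow> norm (T x - T y) \<le> K \<epsilon> * norm (x - y))"

definition nonexpansive :: "('a::real_normed_vector \<Rightarrow> 'a) \<Rightarrow> bool" where
  "nonexpansive T \<longleftrightarrow> (\<forall>x y. norm (T x - T y) \<le> norm (x - y))"

definition super_strongly_nonexpansive :: "('a::real_normed_vector \<Rightarrow> 'a) \<Rightarrow> bool" where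
  "super_strongly_nonexpansive T \<longleftrightarrow>
     nonexpansive T \<and>
     (\<forall>x y :: nat \<Rightarrow> 'a.
        (\<lambda>n. (norm (x n - y n))\<^sup>2 - (norm (T (x n) - T (y n)))\<^sup>2) \<longlonglongrightarrow> 0 \<longrightarrow>
        (\<lambda>n. (x n - y n) - (T (x n) - T (y n))) \<longlonglongrightarrow> 0)"

(* The notion is only defined for super strongly nonexpansive T, so this is
   part of the predicate. *)
definition supercoercivity_modulus ::
    "('a::real_normed_vector \<Rightarrow> 'a) \<Rightarrow> (real \<Rightarrow> real) \<Rightarrow> bool" where
  "supercoercivity_modulus T \<nu> \<longleftrightarrow>
     super_strongly_nonexpansive T \<and>
     \<nu> \<in> {0<..} \<rightarrow> {0<..} \<and>
     (\<forall>M>0. \<forall>x y.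
        (norm (x - y))\<^sup>2 - (norm (T x - T y))\<^sup>2 < M * norm ((x - y) - (T x - T y)) \<longrightarrow>
        norm ((x - y) - (T x - T y)) < \<nu> M)"

end

theory Submission
  imports Defs
begin

text \<open>At distances at least \<open>\<epsilon>\<close> the defect \<open>\<parallel>x - y\<parallel>\<^sup>2 - \<parallel>T x - T y\<parallel>\<^sup>2\<close> is at least
  \<open>(1 - K(\<epsilon>)\<^sup>2) \<parallel>x - y\<parallel>\<^sup>2\<close>, while \<open>\<parallel>(x - y) - (T x - T y)\<parallel> \<le> 2 \<parallel>x - y\<parallel>\<close> by nonexpansiveness.
  So a vanishing defect forces \<open>\<parallel>x - y\<parallel>\<close> to vanish, and comparing the two estimates
  at \<open>\<epsilon> = 1\<close> gives the modulus; the value 2 covers the case \<open>\<parallel>x - y\<parallel> < 1\<close>.\<close>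

text \<open>The last fact supplies a positive defect threshold in the limit argument and a positive
  denominator in the final modulus.\<close>

lemma contraction_for_large_distances_modulus:
  assumes "contraction_for_large_distances T K" "0 < \<epsilon>"
  shows "0 \<le> K \<epsilon>" "K \<epsilon> < 1" "0 < 1 - (K \<epsilon>)\<^sup>2"
proof -
  have "K \<epsilon> \<in> {0..<1}"
    using assms unfolding contraction_for_large_distances_def by (blast intro: funcset_mem)
  then show "0 \<le> K \<epsilon>" "K \<epsilon> < 1" by auto
  then show "0 < 1 - (K \<epsilon>)\<^sup>2"
    by (simp add: power_less_one_iff)
qed

text \<open>For distinct points, \<open>\<epsilon>\<close> can be taken to be their distance itself,
  and the resulting factor is below 1.\<close>

lemma contraction_for_large_distances_nonexpansive:
  assumes "contraction_for_large_distances T K"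
  shows "nonexpansive T"
  unfolding nonexpansive_def
proof (intro allI)
  fix x y
  show "norm (T x - T y) \<le> norm (x - y)"
  proof (cases "x = y")
    case False
    then have pos: "0 < norm (x - y)" by simp
    then have "norm (T x - T y) \<le> K (norm (x - y)) * norm (x - y)"
      using assms unfolding contraction_for_large_distances_def by blast
    also have "\<dots> \<le> norm (x - y)"
      using contraction_for_large_distances_modulus[OF assms pos] by (simp add: mult_left_le_one_le)
    finally show ?thesis .
  qed simp
qed

lemma nonexpansive_norm_diff_le:
  assumes "nonexpansive T"
  shows "norm ((x - y) - (T x - T y)) \<le> 2 * norm (x - y)"
  using norm_triangle_ineq4[of "x - y" "T x - T y"] assms
  unfolding nonexpansive_def by (smt (verit))

lemma contraction_for_large_distances_defect_ge:
  assumes "contraction_for_large_distances T K" "0 < \<epsilon>" "\<epsilon> \<le> norm (x - y)"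
  shows "(1 - (K \<epsilon>)\<^sup>2) * (norm (x - y))\<^sup>2 \<le> (norm (x - y))\<^sup>2 - (norm (T x - T y))\<^sup>2"
proof -
  have "norm (T x - T y) \<le> K \<epsilon> * norm (x - y)"
    using assms unfolding contraction_for_large_distances_def by blast
  then have "(norm (T x - T y))\<^sup>2 \<le> (K \<epsilon> * norm (x - y))\<^sup>2"
    by (intro power_mono) auto
  then show ?thesis
    by (simp add: power_mult_distrib left_diff_distrib)
qed

lemma contraction_for_large_distances_super_strongly_nonexpansive:
  assumes "contraction_for_large_distances T K"
  shows "super_strongly_nonexpansive T"
  unfolding super_strongly_nonexpansive_def
proof (intro conjI allI impI)
  show ne: "nonexpansive T"
    using assms by (rule contraction_for_large_distances_nonexpansive)
  fix x y :: "nat \<Rightarrow> 'a"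
  assume lim: "(\<lambda>n. (norm (x n - y n))\<^sup>2 - (norm (T (x n) - T (y n)))\<^sup>2) \<longlonglongrightarrow> 0"
  have "(\<lambda>n. norm (x n - y n)) \<longlonglongrightarrow> 0"
  proof (rule order_tendstoI)
    fix \<epsilon> :: real assume "0 < \<epsilon>"
    note k = contraction_for_large_distances_modulus[OF assms this]
    \<comment> \<open>The threshold is the lower bound for the defect at distance
      \<open>\<epsilon>\<close>, so a smaller defect rules out any distance of at least
      \<open>\<epsilon>\<close>.\<close>
    have "\<forall>\<^sub>F n in sequentially.
        (norm (x n - y n))\<^sup>2 - (norm (T (x n) - T (y n)))\<^sup>2 < (1 - (K \<epsilon>)\<^sup>2) * \<epsilon>\<^sup>2"
      using k \<open>0 < \<epsilon>\<close> by (intro order_tendstoD(2)[OF lim]) simp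
    then show "\<forall>\<^sub>F n in sequentially. norm (x n - y n) < \<epsilon>"
    proof eventually_elim
      case (elim n)
      show ?case
      proof (rule ccontr)
        assume "\<not> ?case"
        then have le: "\<epsilon> \<le> norm (x n - y n)" by simp
        then have "(1 - (K \<epsilon>)\<^sup>2) * \<epsilon>\<^sup>2 \<le> (1 - (K \<epsilon>)\<^sup>2) * (norm (x n - y n))\<^sup>2"
          using k \<open>0 < \<epsilon>\<close> by (intro mult_left_mono power_mono) auto
        with contraction_for_large_distances_defect_ge[OF assms \<open>0 < \<epsilon>\<close> le] elim
        show False by simp
      qed
    qed
  \<comment> \<open>The remaining half of the limit: a norm exceeds every negative bound.\<close>
  qed (auto intro!: always_eventually intro: less_le_trans)
  then have "(\<lambda>n. 2 * norm (x n - y n)) \<longlonglongrightarrow> 0"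
    by (rule tendsto_mult_right_zero)
  then show "(\<lambda>n. (x n - y n) - (T (x n) - T (y n))) \<longlonglongrightarrow> 0"
    by (rule Lim_null_comparison[rotated])
      (auto intro: always_eventually nonexpansive_norm_diff_le[OF ne])
qed

theorem proposition4p2:
  fixes T :: "'a::{real_inner, complete_space} \<Rightarrow> 'a"
    and K :: "real \<Rightarrow> real"
  assumes "contraction_for_large_distances T K"
  shows "supercoercivity_modulus T (\<lambda>M. max 2 (4 * M / (1 - (K 1)\<^sup>2)))"
  unfolding supercoercivity_modulus_def
proof (intro conjI allI impI)
  show "super_strongly_nonexpansive T"
    using assms by (rule contraction_for_large_distances_super_strongly_nonexpansive)
  show "(\<lambda>M. max 2 (4 * M / (1 - (K 1)\<^sup>2))) \<in> {0<..} \<rightarrow> {0<..}"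
    by (auto simp: less_max_iff_disj)
  fix M :: real and x y :: 'a
  assume "0 < M"
    and less: "(norm (x - y))\<^sup>2 - (norm (T x - T y))\<^sup>2 < M * norm ((x - y) - (T x - T y))"
  define d where "d = norm (x - y)"
  have le: "norm ((x - y) - (T x - T y)) \<le> 2 * d"
    unfolding d_def using assms
    by (intro nonexpansive_norm_diff_le contraction_for_large_distances_nonexpansive)
  show "norm ((x - y) - (T x - T y)) < max 2 (4 * M / (1 - (K 1)\<^sup>2))"
  proof (cases "d < 1")
    case True
    with le show ?thesis by simp
  next
    case False
    have k: "0 < 1 - (K 1)\<^sup>2"
      using contraction_for_large_distances_modulus[OF assms] by simp
    have "(1 - (K 1)\<^sup>2) * d\<^sup>2 < M * norm ((x - y) - (T x - T y))"
      using contraction_for_large_distances_defect_ge[OF assms, of 1 x y] less False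
      unfolding d_def by simp
    also have "\<dots> \<le> M * (2 * d)"
      using le \<open>0 < M\<close> by (intro mult_left_mono) auto
    \<comment> \<open>Both sides are arranged to share the factor \<open>d\<close>, which cancels
      because \<open>d\<close> is at least 1 here.\<close>
    finally have "((1 - (K 1)\<^sup>2) * d) * d < (2 * M) * d"
      by (simp add: power2_eq_square ac_simps)
    then have "(1 - (K 1)\<^sup>2) * d < 2 * M"
      using False by simp
    \<comment> \<open>The 4 arises because the bound by \<open>2 * d\<close> enters twice: above, to
      estimate the defect, and now, to pass from \<open>d\<close> back to the displacement
      difference.\<close>
    then have "2 * d < 4 * M / (1 - (K 1)\<^sup>2)"
      using k by (simp add: pos_less_divide_eq mult.commute)
    with le show ?thesis by simp
  qed
qed

end
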